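(* For every positive integer $n$, $$\sum_{\substack{\pi\in\mathfrak{S}_n\\ \pi\ \text{cyclically } 123\text{-avoiding}}} 2^{\mathbf{bb}^c(\pi)} = n!.$$
   Context: A permutation $\pi\in\mathfrak{S}_n$ is cyclically $123$-avoiding if there is no index $1\le i\le n$ with $\pi_i<\pi_{i+1}<\pi_{i+2}$ (indices modulo $n$), i.e. it has no cyclic double ascent. The number of cyclic double descents is $\mathbf{bb}^c(\pi)=\#\{i\in\{1,\ldots,n\}: \pi_i>\pi_{i+1}>\pi_{i+2}\}$, indices modulo $n$. *)

theory Defs
  imports Main "HOL-Combinatorics.Permutations"
begin

text \<open>Positions are the elements of \<open>{1..n}\<close>, read modulo \<open>n\<close>: the successor of \<open>n\<close> is \<open>1\<close>.\<close>

definition cyc_succ :: "nat \<Rightarrow> nat \<Rightarrow> nat" where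
  "cyc_succ n i = i mod n + 1"

definition cyclically_123_avoiding :: "nat \<Rightarrow> (nat \<Rightarrow> nat) \<Rightarrow> bool" where
  "cyclically_123_avoiding n \<pi> \<longleftrightarrow>
     \<not> (\<exists>i\<in>{1..n}. \<pi> i < \<pi> (cyc_succ n i) \<and>
                   \<pi> (cyc_succ n i) < \<pi> (cyc_succ n (cyc_succ n i)))"

definition cyc_double_descents :: "nat \<Rightarrow> (nat \<Rightarrow> nat) \<Rightarrow> nat" where
  "cyc_double_descents n \<pi> =
     card {i\<in>{1..n}. \<pi> i > \<pi> (cyc_succ n i) \<and>
                     \<pi> (cyc_succ n i) > \<pi> (cyc_succ n (cyc_succ n i))}"

end

theory Submission
  imports Defs "HOL-Combinatorics.Multiset_Permutations"
begin

text \<open>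
  Weight every cyclic double ascent by \<open>a\<close> and every cyclic double descent by \<open>b\<close>. The total
  weight of all permutations depends only on \<open>a + b\<close>, and the theorem compares the weights
  \<open>(0, 2)\<close> and \<open>(1, 1)\<close>.

  Rotating the maximum \<open>M\<close> to the last position reduces the cyclic sum to the words \<open>w\<close> on the
  other letters, framed as \<open>T w T\<close> by a letter \<open>T\<close> larger than all of \<open>w\<close>. When a framed word is
  split at its own maximum, that letter serves as a frame of both parts. The triple centred at it is
  a double descent if only the left part is empty, a double ascent if only the right part is, and
  neither otherwise. So in the recursion for the framed sums \<open>a\<close> and \<open>b\<close> enter only through
  \<open>(a + b)\<close> times the sum for the words without the maximum.
\<close>

definition triple_weight :: "'b::comm_semiring_1 \<Rightarrow> 'b \<Rightarrow> 'a::linorder \<Rightarrow> 'a \<Rightarrow> 'a \<Rightarrow> 'b" where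
  "triple_weight a b x y z =
     (if x < y \<and> y < z then a else 1) * (if x > y \<and> y > z then b else 1)"

lemma triple_weight_double_ascent: "x < y \<Longrightarrow> y < z \<Longrightarrow> triple_weight a b x y z = a"
  by (auto simp: triple_weight_def)

lemma triple_weight_double_descent: "x > y \<Longrightarrow> y > z \<Longrightarrow> triple_weight a b x y z = b"
  by (auto simp: triple_weight_def)

lemma triple_weight_turn: "x < y \<longleftrightarrow> z < y \<Longrightarrow> triple_weight a b x y z = 1"
  by (auto simp: triple_weight_def)

fun list_weight :: "'b::comm_semiring_1 \<Rightarrow> 'b \<Rightarrow> 'a::linorder list \<Rightarrow> 'b" where
  "list_weight a b (x # y # z # zs) = triple_weight a b x y z * list_weight a b (y # z # zs)"
| "list_weight _ _ _ = 1"

lemma list_weight_append: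
  "list_weight a b (xs @ x # y # ys) =
     list_weight a b (xs @ [x, y]) * list_weight a b (x # y # ys)"
proof (induction xs)
  case (Cons z xs)
  then show ?case
    by (cases xs; cases "tl xs") (simp_all add: mult.assoc)
qed simp

lemma list_weight_eq_prod:
  "list_weight a b xs =
     (\<Prod>i<length xs - 2. triple_weight a b (xs ! i) (xs ! Suc i) (xs ! Suc (Suc i)))"
  by (induction a b xs rule: list_weight.induct)
     (simp_all add: prod.lessThan_Suc_shift del: prod.lessThan_Suc)

lemma list_weight_replace_hd:
  assumes "y < x" "y < x'"
  shows "list_weight a b (x # y # ys) = list_weight a b (x' # y # ys)"
  using assms by (cases ys) (auto simp: triple_weight_def)

lemma list_weight_replace_last:
  assumes "x < y" "x < y'"
  shows "list_weight a b (xs @ [x, y]) = list_weight a b (xs @ [x, y'])"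
proof (cases xs rule: rev_cases)
  case (snoc zs z)
  have "triple_weight a b z x y = triple_weight a b z x y'"
    using assms by (auto simp: triple_weight_def)
  then show ?thesis
    using snoc list_weight_append[of a b zs z x "[_]"] by simp
qed simp

lemma list_weight_split_max:
  assumes "\<forall>x\<in>set u \<union> set v. x < M" "M < T"
  shows "list_weight a b (T # (u @ M # v) @ [T]) =
           triple_weight a b (last (T # u)) M (hd (v @ [T])) *
           (list_weight a b (T # u @ [T]) * list_weight a b (T # v @ [T]))"
proof -
  have left: "list_weight a b (T # u @ [M]) = list_weight a b (T # u @ [T])"
  proof (cases u rule: rev_cases)
    case (snoc u' x)
    then show ?thesis
      using assms list_weight_replace_last[of x M T a b "T # u'"] by force
  qed simp
  have right: "list_weight a b (M # v @ [T]) = list_weight a b (T # v @ [T])"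
  proof (cases v)
    case (Cons y v')
    then show ?thesis
      using assms by (auto intro!: list_weight_replace_hd)
  qed simp
  define x y where "x = last (T # u)" and "y = hd (v @ [T])"
  obtain u' where u': "T # u = u' @ [x]"
    unfolding x_def by (metis append_butlast_last_id list.distinct(1))
  obtain v' where v': "v @ [T] = y # v'"
    unfolding y_def by (metis append_is_Nil_conv list.collapse list.distinct(1))
  have "list_weight a b (T # (u @ M # v) @ [T]) = list_weight a b (u' @ x # M # y # v')"
    using u' v' by (metis append.assoc append_Cons append_Nil)
  also have "\<dots> = list_weight a b (u' @ [x, M]) *
      (triple_weight a b x M y * list_weight a b (M # y # v'))"
    by (subst list_weight_append) simp
  also have "u' @ [x, M] = T # u @ [M]"
    using u' by (metis append.assoc append_Cons append_Nil)
  also have "M # y # v' = M # v @ [T]"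
    using v' by simp
  finally show ?thesis
    unfolding left right x_def y_def by (simp only: mult.left_commute)
qed

lemma list_weight_split_max_cases:
  assumes "\<forall>x\<in>set u \<union> set v. x < M" "M < T" "u \<noteq> [] \<or> v \<noteq> []"
  shows "list_weight a b (T # (u @ M # v) @ [T]) =
           (if u = [] then b else if v = [] then a else 1) *
           (list_weight a b (T # u @ [T]) * list_weight a b (T # v @ [T]))"
proof -
  have "u \<noteq> [] \<Longrightarrow> last u < M" "v \<noteq> [] \<Longrightarrow> hd v < M"
    using assms(1) last_in_set hd_in_set by blast+
  then have "triple_weight a b (last (T # u)) M (hd (v @ [T])) =
      (if u = [] then b else if v = [] then a else 1)"
    using assms(2,3)
    by (auto simp: triple_weight_double_ascent triple_weight_double_descent triple_weight_turn)
  then show ?thesis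
    using list_weight_split_max[OF assms(1,2), of a b] by simp
qed

lemma bij_betw_permutations_of_set_insert_split:
  assumes "M \<notin> S"
  shows "bij_betw (\<lambda>(A, u, v). u @ M # v)
    (SIGMA A:Pow S. permutations_of_set A \<times> permutations_of_set (S - A))
    (permutations_of_set (insert M S))"
    (is "bij_betw ?join ?D ?P")
proof (rule bij_betw_imageI)
  show "inj_on ?join ?D"
  proof (rule inj_onI)
    fix s t assume "s \<in> ?D" "t \<in> ?D" and eq: "?join s = ?join t"
    then obtain A u v A' u' v' where st: "s = (A, u, v)" "t = (A', u', v')"
      and u: "u \<in> permutations_of_set A" "u' \<in> permutations_of_set A'"
      and v: "v \<in> permutations_of_set (S - A)" and "A \<subseteq> S"
      by (cases s; cases t) auto
    have "M \<notin> set u" "M \<notin> set v"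
      using u v \<open>A \<subseteq> S\<close> assms by (auto dest: permutations_of_setD(1))
    then have "u = u'" "v = v'"
      using eq st by (simp_all add: append_Cons_eq_iff)
    then show "s = t"
      using st u by (auto dest: permutations_of_setD(1))
  qed
  show "?join ` ?D = ?P"
  proof (intro equalityI subsetI)
    fix w assume w: "w \<in> ?P"
    then obtain u v where uv: "w = u @ M # v"
      by (metis insertI1 permutations_of_setD(1) split_list)
    then have "(set u, u, v) \<in> ?D"
      using w assms by (auto simp: permutations_of_set_def)
    then show "w \<in> ?join ` ?D"
      using uv by (intro image_eqI[of _ _ "(set u, u, v)"]) simp_all
  qed (use assms in \<open>auto simp: permutations_of_set_def\<close>)
qed

lemma sum_permutations_of_set_insert_split:
  assumes "finite S" "M \<notin> S"
  shows "(\<Sum>w\<in>permutations_of_set (insert M S). f w) =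
    (\<Sum>A\<in>Pow S. \<Sum>u\<in>permutations_of_set A. \<Sum>v\<in>permutations_of_set (S - A). f (u @ M # v))"
proof -
  let ?D = "\<lambda>A. permutations_of_set A \<times> permutations_of_set (S - A)"
  have "(\<Sum>w\<in>permutations_of_set (insert M S). f w) =
      (\<Sum>(A, u, v)\<in>(SIGMA A:Pow S. ?D A). f (u @ M # v))"
    using sum.reindex_bij_betw[OF bij_betw_permutations_of_set_insert_split[OF assms(2)], of f]
    by (simp add: case_prod_beta)
  also have "\<dots> = (\<Sum>A\<in>Pow S. \<Sum>(u, v)\<in>?D A. f (u @ M # v))"
    using assms(1) by (subst sum.Sigma) auto
  finally show ?thesis by (simp add: sum.cartesian_product)
qed

definition framed_weight_sum :: "'b::comm_semiring_1 \<Rightarrow> 'b \<Rightarrow> 'a::linorder \<Rightarrow> 'a set \<Rightarrow> 'b" where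
  "framed_weight_sum a b T S = (\<Sum>w\<in>permutations_of_set S. list_weight a b (T # w @ [T]))"

lemma framed_weight_sum_empty [simp]: "framed_weight_sum a b T {} = 1"
  by (simp add: framed_weight_sum_def)

lemma framed_weight_sum_singleton:
  "x < T \<Longrightarrow> framed_weight_sum a b T {x} = 1"
  by (simp add: framed_weight_sum_def triple_weight_turn)

lemma sum_list_weight_split_max:
  assumes "R \<noteq> {}" "\<forall>x\<in>R. x < M" "M < T" "A \<subseteq> R"
  shows "(\<Sum>u\<in>permutations_of_set A. \<Sum>v\<in>permutations_of_set (R - A).
            list_weight a b (T # (u @ M # v) @ [T])) =
         (if A = {} then b else if A = R then a else 1) *
         (framed_weight_sum a b T A * framed_weight_sum a b T (R - A))"
    (is "_ = ?c * _")
proof -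
  have word: "list_weight a b (T # (u @ M # v) @ [T]) =
      ?c * (list_weight a b (T # u @ [T]) * list_weight a b (T # v @ [T]))"
    if "u \<in> permutations_of_set A" "v \<in> permutations_of_set (R - A)" for u v
  proof -
    have "set u = A" "set v = R - A"
      using that by (auto dest: permutations_of_setD)
    moreover from this have "u = [] \<longleftrightarrow> A = {}" "v = [] \<longleftrightarrow> A = R"
      using assms(4) by auto
    ultimately show ?thesis
      using assms by (subst list_weight_split_max_cases) auto
  qed
  show ?thesis
    unfolding framed_weight_sum_def sum_product
    by (simp only: word sum_distrib_left cong: sum.cong)
qed

lemma framed_weight_sum_insert_max:
  assumes "finite R" "R \<noteq> {}" "\<forall>x\<in>R. x < M" "M < T"
  shows "framed_weight_sum a b T (insert M R) =
    (a + b) * framed_weight_sum a b T R +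
    (\<Sum>A\<in>Pow R - {{}, R}. framed_weight_sum a b T A * framed_weight_sum a b T (R - A))"
proof -
  let ?W = "framed_weight_sum a b T"
  let ?c = "\<lambda>A. if A = {} then b else if A = R then a else 1"
  have "M \<notin> R" using assms(3) by auto
  have "?W (insert M R) = (\<Sum>A\<in>Pow R. ?c A * (?W A * ?W (R - A)))"
    unfolding framed_weight_sum_def[of a b T "insert M R"]
      sum_permutations_of_set_insert_split[OF assms(1) \<open>M \<notin> R\<close>]
    by (intro sum.cong refl sum_list_weight_split_max assms(2-4)) simp
  also have "Pow R = insert {} (insert R (Pow R - {{}, R}))"
    by auto
  also have "(\<Sum>A\<in>\<dots>. ?c A * (?W A * ?W (R - A))) =
      b * ?W R + (a * ?W R + (\<Sum>A\<in>Pow R - {{}, R}. ?c A * (?W A * ?W (R - A))))"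
    using assms(1,2) by simp
  also have "(\<Sum>A\<in>Pow R - {{}, R}. ?c A * (?W A * ?W (R - A))) =
      (\<Sum>A\<in>Pow R - {{}, R}. ?W A * ?W (R - A))"
    by (intro sum.cong) auto
  finally show ?thesis by (simp add: algebra_simps)
qed

lemma framed_weight_sum_cong:
  assumes "a + b = c + d" "finite S" "\<forall>x\<in>S. x < T"
  shows "framed_weight_sum a b T S = framed_weight_sum c d T S"
  using assms(2,3)
proof (induction S rule: finite_psubset_induct)
  case (psubset S)
  show ?case
  proof (cases "S = {}")
    case False
    define M where "M = Max S"
    define R where "R = S - {M}"
    have "M \<in> S" using psubset.hyps False by (simp add: M_def)
    then have S: "S = insert M R" by (auto simp: R_def)
    have M: "\<forall>x\<in>R. x < M" "M < T"
      using psubset.hyps psubset.prems \<open>M \<in> S\<close> by (auto simp: R_def M_def order.strict_iff_order)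
    have "R \<subset> S" using \<open>M \<in> S\<close> by (auto simp: R_def)
    then have IH: "framed_weight_sum a b T A = framed_weight_sum c d T A" if "A \<subseteq> R" for A
      using that psubset.prems by (intro psubset.IH) auto
    show ?thesis
    proof (cases "R = {}")
      case True
      then show ?thesis using S M by (simp add: framed_weight_sum_singleton)
    next
      case False
      have "finite R" using psubset.hyps by (simp add: R_def)
      note rec = framed_weight_sum_insert_max[OF this False M]
      show ?thesis
        unfolding S rec assms(1) by (intro arg_cong2[of _ _ _ _ "(+)"] sum.cong) (auto simp: IH)
    qed
  qed simp
qed

definition cyclic_weight :: "'b::comm_semiring_1 \<Rightarrow> 'b \<Rightarrow> 'a::linorder list \<Rightarrow> 'b" where
  "cyclic_weight a b xs = list_weight a b (last xs # xs @ [hd xs])"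

lemma cyclic_weight_rotate1: "cyclic_weight a b (rotate1 xs) = cyclic_weight a b xs"
proof (cases xs)
  case (Cons x ys)
  show ?thesis
  proof (cases "ys = []")
    case False
    then obtain y vs where y: "ys = y # vs" by (cases ys) auto
    from False obtain us z where z: "ys = us @ [z]" by (cases ys rule: rev_cases) auto
    then have "last ys = z" by simp
    have "cyclic_weight a b (rotate1 xs) = list_weight a b (x # ys @ [x, y])"
      using Cons y by (simp add: cyclic_weight_def)
    also have "\<dots> = list_weight a b ((x # us) @ z # x # [y])"
      using z by simp
    also have "\<dots> = list_weight a b (x # ys @ [x]) * triple_weight a b z x y"
      using z by (subst list_weight_append) simp
    also have "\<dots> = list_weight a b (z # x # y # vs @ [x])"
      using y by (simp add: mult.commute)
    also have "\<dots> = cyclic_weight a b xs"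
      using Cons y \<open>last ys = z\<close> by (simp add: cyclic_weight_def)
    finally show ?thesis .
  qed (simp add: Cons)
qed simp

lemma cyclic_weight_rotate: "cyclic_weight a b (rotate k xs) = cyclic_weight a b xs"
  by (induction k) (simp_all add: cyclic_weight_rotate1)

lemma cyclic_weight_snoc_max:
  assumes "\<forall>x\<in>set w. x < M"
  shows "cyclic_weight a b (w @ [M]) = list_weight a b (M # w @ [M])"
proof (cases w rule: rev_cases)
  case (snoc u x)
  have "cyclic_weight a b (w @ [M]) = list_weight a b ((M # u) @ x # M # [hd w])"
    using snoc by (simp add: cyclic_weight_def hd_append)
  also have "\<dots> = list_weight a b (M # w @ [M]) * triple_weight a b x M (hd w)"
    using snoc by (subst list_weight_append) simp
  also have "triple_weight a b x M (hd w) = 1"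
    using assms snoc by (intro triple_weight_turn) (auto simp: hd_append)
  finally show ?thesis by simp
qed (simp add: cyclic_weight_def triple_weight_def)

lemma sum_permutations_of_set_insert_rotate:
  assumes "finite S" "M \<notin> S"
  shows "(\<Sum>w\<in>permutations_of_set (insert M S). f w) =
    (\<Sum>w\<in>permutations_of_set S. \<Sum>k\<le>card S. f (rotate k (w @ [M])))"
proof -
  let ?D = "permutations_of_set S \<times> {..card S}"
  let ?rot = "\<lambda>(w, k). rotate k (w @ [M])"
  have image: "?rot ` ?D = permutations_of_set (insert M S)"
  proof (intro equalityI subsetI)
    fix w assume "w \<in> ?rot ` ?D"
    then show "w \<in> permutations_of_set (insert M S)"
      using assms(2) by (auto simp: permutations_of_set_def)
  next
    fix w assume w: "w \<in> permutations_of_set (insert M S)"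
    then obtain u v where uv: "w = u @ M # v"
      by (metis insertI1 permutations_of_setD(1) split_list)
    then have "v @ u \<in> permutations_of_set S"
      using w assms(2) by (auto simp: permutations_of_set_def)
    moreover from this have "length v \<le> card S"
      using length_finite_permutations_of_set by fastforce
    moreover have "w = rotate (length v) ((v @ u) @ [M])"
      using uv rotate_append[of v "u @ [M]"] by simp
    ultimately show "w \<in> ?rot ` ?D" by force
  qed
  have "card (?rot ` ?D) = card ?D"
    unfolding image using assms by (simp add: card_cartesian_product)
  then have inj: "inj_on ?rot ?D"
    by (intro eq_card_imp_inj_on) simp_all
  show ?thesis
    unfolding image[symmetric] sum.reindex[OF inj]
    by (simp add: sum.cartesian_product case_prod_beta)
qed

lemma sum_cyclic_weight_insert_max:
  assumes "finite S" "\<forall>x\<in>S. x < M"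
  shows "(\<Sum>w\<in>permutations_of_set (insert M S). cyclic_weight a b w) =
    of_nat (Suc (card S)) * framed_weight_sum a b M S"
proof -
  have "M \<notin> S" using assms(2) by auto
  then have "(\<Sum>w\<in>permutations_of_set (insert M S). cyclic_weight a b w) =
      (\<Sum>w\<in>permutations_of_set S. of_nat (Suc (card S)) * cyclic_weight a b (w @ [M]))"
    using assms(1) by (simp add: sum_permutations_of_set_insert_rotate cyclic_weight_rotate)
  also have "\<dots> = (\<Sum>w\<in>permutations_of_set S.
      of_nat (Suc (card S)) * list_weight a b (M # w @ [M]))"
    using assms(2) by (intro sum.cong)
      (auto simp: cyclic_weight_snoc_max dest: permutations_of_setD(1))
  finally show ?thesis
    by (simp add: framed_weight_sum_def sum_distrib_left)
qed

lemma sum_cyclic_weight_cong: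
  assumes "a + b = c + d" "finite S"
  shows "(\<Sum>w\<in>permutations_of_set S. cyclic_weight a b w) =
    (\<Sum>w\<in>permutations_of_set S. cyclic_weight c d w)"
proof (cases "S = {}")
  case False
  define R where "R = S - {Max S}"
  have R: "finite R" "\<forall>x\<in>R. x < Max S"
    using assms(2) by (auto simp: R_def order.strict_iff_order)
  have "S = insert (Max S) R"
    using Max_in[OF assms(2) False] by (auto simp: R_def)
  then show ?thesis
    using sum_cyclic_weight_insert_max[OF R] framed_weight_sum_cong[OF assms(1) R] by metis
qed (simp add: cyclic_weight_def)

definition cyc_double_ascents :: "nat \<Rightarrow> (nat \<Rightarrow> nat) \<Rightarrow> nat" where
  "cyc_double_ascents n \<pi> =
     card {i\<in>{1..n}. \<pi> i < \<pi> (cyc_succ n i) \<and>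
                     \<pi> (cyc_succ n i) < \<pi> (cyc_succ n (cyc_succ n i))}"

lemma cyclically_123_avoiding_iff:
  "cyclically_123_avoiding n \<pi> \<longleftrightarrow> cyc_double_ascents n \<pi> = 0"
  by (auto simp: cyclically_123_avoiding_def cyc_double_ascents_def)

lemma cyclic_weight_map_upt:
  "cyclic_weight a b (map \<pi> [1..<Suc n]) =
     (\<Prod>i\<in>{1..n}. triple_weight a b (\<pi> i) (\<pi> (cyc_succ n i)) (\<pi> (cyc_succ n (cyc_succ n i))))"
proof (cases n)
  case (Suc m)
  let ?t = "\<lambda>i. triple_weight a b (\<pi> i) (\<pi> (cyc_succ n i)) (\<pi> (cyc_succ n (cyc_succ n i)))"
  define xs where "xs = \<pi> n # map \<pi> [1..<Suc n] @ [\<pi> 1]"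
  have nth: "xs ! i = \<pi> (if i = 0 then n else if i = Suc n then 1 else i)" if "i \<le> Suc n" for i
    using that by (auto simp: xs_def nth_Cons nth_append split: nat.splits simp del: upt_Suc)
  let ?s = "\<lambda>i. triple_weight a b (xs ! i) (xs ! Suc i) (xs ! Suc (Suc i))"
  have "cyclic_weight a b (map \<pi> [1..<Suc n]) = list_weight a b xs"
    using Suc by (simp add: cyclic_weight_def xs_def hd_map last_map del: upt_Suc)
  also have "\<dots> = (\<Prod>i<Suc m. ?s i)"
    unfolding list_weight_eq_prod using Suc by (simp add: xs_def del: upt_Suc)
  also have "\<dots> = ?s 0 * (\<Prod>i<m. ?s (Suc i))"
    by (rule prod.lessThan_Suc_shift)
  also have "?s 0 = ?t n"
    using Suc by (simp add: nth cyc_succ_def)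
  also have "(\<Prod>i<m. ?s (Suc i)) = (\<Prod>i<m. ?t (Suc i))"
    using Suc by (intro prod.cong) (auto simp: nth cyc_succ_def)
  also have "(\<Prod>i<m. ?t (Suc i)) = (\<Prod>i=1..m. ?t i)"
    by (simp add: prod.atLeast1_atMost_eq)
  finally show ?thesis using Suc by (simp add: mult.commute)
qed (simp add: cyclic_weight_def)

lemma cyclic_weight_permutation:
  "cyclic_weight a b (map \<pi> [1..<Suc n]) =
     a ^ cyc_double_ascents n \<pi> * b ^ cyc_double_descents n \<pi>"
  unfolding cyclic_weight_map_upt triple_weight_def prod.distrib
  by (simp add: prod.inter_filter[symmetric] cyc_double_ascents_def cyc_double_descents_def)

lemma bij_betw_map_permutes:
  assumes "distinct xs"
  shows "bij_betw (\<lambda>\<pi>. map \<pi> xs) {\<pi>. \<pi> permutes set xs} (permutations_of_set (set xs))"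
proof -
  let ?P = "{\<pi>. \<pi> permutes set xs}"
  have inj: "inj_on (\<lambda>\<pi>. map \<pi> xs) ?P"
    by (intro inj_onI ext) (metis map_eq_conv mem_Collect_eq permutes_not_in)
  have "(\<lambda>\<pi>. map \<pi> xs) ` ?P = permutations_of_set (set xs)"
  proof (rule card_subset_eq)
    show "(\<lambda>\<pi>. map \<pi> xs) ` ?P \<subseteq> permutations_of_set (set xs)"
      using assms permutations_of_set_image_permutes by blast
    show "card ((\<lambda>\<pi>. map \<pi> xs) ` ?P) = card (permutations_of_set (set xs))"
      using inj by (simp add: card_image card_permutations)
  qed simp
  with inj show ?thesis by (simp add: bij_betw_def)
qed

lemma sum_cyc_double_run_powers_cong:
  fixes a b c d :: "'b::comm_semiring_1"
  assumes "a + b = c + d"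
  shows "(\<Sum>\<pi> | \<pi> permutes {1..n}. a ^ cyc_double_ascents n \<pi> * b ^ cyc_double_descents n \<pi>) =
         (\<Sum>\<pi> | \<pi> permutes {1..n}. c ^ cyc_double_ascents n \<pi> * d ^ cyc_double_descents n \<pi>)"
proof -
  have words: "(\<Sum>\<pi> | \<pi> permutes {1..n}.
        p ^ cyc_double_ascents n \<pi> * q ^ cyc_double_descents n \<pi>) =
      (\<Sum>w\<in>permutations_of_set {1..n}. cyclic_weight p q w)" for p q :: 'b
    using sum.reindex_bij_betw[OF bij_betw_map_permutes[of "[1..<Suc n]"], of "cyclic_weight p q"]
    by (simp only: cyclic_weight_permutation distinct_upt set_upt atLeastLessThanSuc_atLeastAtMost)
  show ?thesis
    unfolding words using assms by (intro sum_cyclic_weight_cong) simp_all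
qed

theorem theorem3p4:
  fixes n :: nat
  assumes "n \<ge> 1"
  shows "(\<Sum>\<pi> | \<pi> permutes {1..n} \<and> cyclically_123_avoiding n \<pi>.
            (2::nat) ^ cyc_double_descents n \<pi>) = fact n"
proof -
  let ?P = "{\<pi>. \<pi> permutes {1..n}}"
  have "(\<Sum>\<pi> | \<pi> permutes {1..n} \<and> cyclically_123_avoiding n \<pi>.
            (2::nat) ^ cyc_double_descents n \<pi>) =
        (\<Sum>\<pi>\<in>?P. if cyclically_123_avoiding n \<pi> then 2 ^ cyc_double_descents n \<pi> else 0)"
    using sum.inter_filter[of ?P] by (simp add: finite_permutations)
  also have "\<dots> = (\<Sum>\<pi>\<in>?P. 0 ^ cyc_double_ascents n \<pi> * 2 ^ cyc_double_descents n \<pi>)"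
    by (intro sum.cong) (auto simp: cyclically_123_avoiding_iff)
  also have "\<dots> = (\<Sum>\<pi>\<in>?P. 1 ^ cyc_double_ascents n \<pi> * 1 ^ cyc_double_descents n \<pi>)"
    by (rule sum_cyc_double_run_powers_cong) simp
  also have "\<dots> = fact n"
    by (simp add: card_permutations)
  finally show ?thesis .
qed

end
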